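(* Let $D$ be a digraph of order $n$ and let $W\subseteq V(D)$ with $n\geq 2|W|$. If $\delta^0(W)\geq \frac{n}{2}+|W|-1$, then $D$ contains an arbitrary $W$-cycle-factor; that is, for every integer $k\geq 1$ and all integers $n_1,\ldots,n_k\geq 2$ with $|W|=n_1+\cdots+n_k$, there are $k$ pairwise vertex-disjoint directed cycles $C_1,\ldots,C_k$ in $D$ such that $|V(C_i)\cap W|=n_i$ for each $1\leq i\leq k$.
   Context: Digraphs are finite and simple: no loops and no multiple arcs, but both arcs $uv$ and $vu$ may be present. The order of $D$ is $|V(D)|$. Cycles are directed; directed cycles of length $2$ are allowed. For $v\in V(D)$, $d^+_D(v)$ and $d^-_D(v)$ denote the out-degree and in-degree of $v$ in $D$. For $W\subseteq V(D)$, $\delta^+(W)=\min\{d^+_D(v): v\in W\}$, $\delta^-(W)=\min\{d^-_D(v): v\in W\}$, and $\delta^0(W)=\min\{\delta^+(W),\delta^-(W)\}$ (degrees are taken in the whole of $D$). *)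

theory Defs
  imports Complex_Main "Graph_Theory.Graph_Theory"
begin

text \<open>
  The minima are only meaningful for finite nonempty \<open>W\<close>; the value of
  \<open>Min\<close> on the empty set is unspecified.
\<close>

definition min_out_degree :: "('a, 'b) pre_digraph \<Rightarrow> 'a set \<Rightarrow> nat" where
  "min_out_degree D W = Min (out_degree D ` W)"

definition min_in_degree :: "('a, 'b) pre_digraph \<Rightarrow> 'a set \<Rightarrow> nat" where
  "min_in_degree D W = Min (in_degree D ` W)"

definition min_semi_degree :: "('a, 'b) pre_digraph \<Rightarrow> 'a set \<Rightarrow> nat" where
  "min_semi_degree D W = min (min_out_degree D W) (min_in_degree D W)"

text \<open>
  A cycle is given by its list of arcs, as in \<open>pre_digraph.cycle\<close>, which puts no
  lower bound on the length: 2-cycles are allowed, and loops are excluded only by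
  assuming \<open>loopfree_digraph\<close>.
\<close>

definition cycle_verts :: "('a, 'b) pre_digraph \<Rightarrow> 'b awalk \<Rightarrow> 'a set" where
  "cycle_verts D p = tail D ` set p \<union> head D ` set p"

definition arbitrary_cycle_factor :: "('a, 'b) pre_digraph \<Rightarrow> 'a set \<Rightarrow> bool" where
  "arbitrary_cycle_factor D W \<longleftrightarrow>
    (\<forall>(k::nat) (m :: nat \<Rightarrow> nat).
      1 \<le> k \<longrightarrow> (\<forall>i\<in>{1..k}. 2 \<le> m i) \<longrightarrow> card W = (\<Sum>i=1..k. m i) \<longrightarrow>
      (\<exists>C :: nat \<Rightarrow> 'b awalk.
        (\<forall>i\<in>{1..k}. pre_digraph.cycle D (C i)) \<and>
        (\<forall>i\<in>{1..k}. \<forall>j\<in>{1..k}. i \<noteq> j \<longrightarrow> cycle_verts D (C i) \<inter> cycle_verts D (C j) = {}) \<and>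
        (\<forall>i\<in>{1..k}. card (cycle_verts D (C i) \<inter> W) = m i)))"

end

theory Submission
  imports Defs
begin

text \<open>
  A vertex of \<open>W\<close> has at most \<open>card W - 1\<close> neighbours inside \<open>W\<close>, hence at least \<open>n / 2\<close>
  out-neighbours and at least \<open>n / 2\<close> in-neighbours outside. As only \<open>n - card W\<close> vertices lie
  outside \<open>W\<close>, any two vertices \<open>u, v\<close> of \<open>W\<close> have at least \<open>card W\<close> common vertices \<open>z\<close>
  outside \<open>W\<close> with \<open>u \<rightarrow> z \<rightarrow> v\<close>. Arrange \<open>W\<close> arbitrarily into cyclic sequences of the
  prescribed lengths; the \<open>card W\<close> consecutive pairs can then be linked greedily through
  distinct outside vertices.
\<close>

text \<open>Every \<open>S a\<close> has at least as many elements as there are indices, so the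
  representatives already chosen, being fewer, cannot exhaust it.\<close>

lemma greedy_distinct_representatives:
  assumes "finite A" and "\<And>a. a \<in> A \<Longrightarrow> finite (S a)"
    and "\<And>a. a \<in> A \<Longrightarrow> card A \<le> card (S a)"
  shows "\<exists>f. inj_on f A \<and> (\<forall>a\<in>A. f a \<in> S a)"
  using assms
proof (induction A rule: finite_induct)
  case empty
  then show ?case by simp
next
  case (insert a A)
  have "\<exists>f. inj_on f A \<and> (\<forall>a\<in>A. f a \<in> S a)"
    by (rule insert.IH) (use insert in fastforce)+
  then obtain f where f: "inj_on f A" "\<forall>a\<in>A. f a \<in> S a" by blast
  have "card (f ` A) < card (S a)"
    using card_image_le[OF insert.hyps(1), of f] insert.prems(2)[of a] insert.hyps by simp
  then have "\<not> S a \<subseteq> f ` A"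
    using card_mono[of "f ` A" "S a"] insert.hyps(1) by fastforce
  then obtain z where z: "z \<in> S a" "z \<notin> f ` A" by blast
  have "inj_on (f(a := z)) (insert a A)"
    using f(1) z(2) insert.hyps(2) by (auto simp: inj_on_def)
  moreover have "\<forall>b\<in>insert a A. (f(a := z)) b \<in> S b"
    using f(2) z(1) by auto
  ultimately show ?case by blast
qed

text \<open>Bridge from closed vertex sequences, which are easy to build, to the arc lists on which
  \<open>cycle\<close> is defined.\<close>

lemma (in wf_digraph) cycle_of_sequence:
  assumes "0 < L" and step: "\<And>j. j < L \<Longrightarrow> v j \<rightarrow>\<^bsub>G\<^esub> v (Suc j)"
    and closed: "v L = v 0" and inj: "inj_on v {..<L}"
  shows "\<exists>p. cycle p \<and> cycle_verts G p = v ` {..<L}"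
proof -
  have "\<forall>j\<in>{..<L}. \<exists>a. a \<in> arcs G \<and> tail G a = v j \<and> head G a = v (Suc j)"
    using step by (auto elim!: reachableE)
  then obtain e where e: "\<And>j. j < L \<Longrightarrow> e j \<in> arcs G"
    "\<And>j. j < L \<Longrightarrow> tail G (e j) = v j" "\<And>j. j < L \<Longrightarrow> head G (e j) = v (Suc j)"
    unfolding bchoice_iff by auto
  let ?p = "map e [0..<L]"
  have v0: "v 0 \<in> verts G"
    using e(1,2)[of 0] \<open>0 < L\<close> tail_in_verts[of "e 0"] by simp
  have "awalk (v 0) (map e [0..<l]) (v l)" if "l \<le> L" for l
    using that
  proof (induction l)
    case 0
    then show ?case using v0 by (simp add: awalk_Nil_iff)
  next
    case (Suc l)
    have "awalk (v l) [e l] (v (Suc l))"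
      using e[of l] head_in_verts[of "e l"] Suc.prems by (simp add: awalk_simps)
    then have "awalk (v 0) (map e [0..<l] @ [e l]) (v (Suc l))"
      using Suc by (intro awalk_appendI[where v = "v l"]) auto
    then show ?case by simp
  qed
  then have walk: "awalk (v 0) ?p (v 0)"
    using closed by (metis order_refl)
  \<comment> \<open>Since \<open>v L = v 0\<close>, shifting by one keeps the vertex set. The
    shifted sequence lists the heads of the arcs; having \<open>L\<close> distinct values on
    \<open>L\<close> indices, it is injective, which is the distinctness that \<open>cycle\<close>
    demands.\<close>
  have image_Suc: "(v \<circ> Suc) ` {0..<L} = v ` {..<L}"
  proof -
    have "v ` {..<L} = v ` {1..L}"
    proof -
      have "{..<L} = insert 0 {1..<L}" "{1..L} = insert L {1..<L}"
        using \<open>0 < L\<close> by auto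
      then show ?thesis using closed by simp
    qed
    then show ?thesis
      by (simp add: image_image[symmetric, of v Suc] image_Suc_atLeastLessThan
          atLeastLessThanSuc_atLeastAtMost)
  qed
  then have "inj_on (v \<circ> Suc) {0..<L}"
    using inj by (intro eq_card_imp_inj_on) (simp_all add: card_image)
  moreover have "tl (awalk_verts (v 0) ?p) = map (v \<circ> Suc) [0..<L]"
    using walk e(3) \<open>0 < L\<close> by (subst awalk_verts_conv') auto
  ultimately have "cycle ?p"
    using walk \<open>0 < L\<close> unfolding cycle_def by (auto simp: distinct_map)
  moreover have "cycle_verts G ?p = v ` {..<L}"
  proof -
    have "tail G ` set ?p = v ` {..<L}" "head G ` set ?p = (v \<circ> Suc) ` {0..<L}"
      using e(2,3) by (force simp: image_image)+
    then show ?thesis using image_Suc by (simp add: cycle_verts_def)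
  qed
  ultimately show ?thesis by blast
qed

lemma (in wf_digraph) cycle_alternating:
  assumes "0 < m" and inj: "inj_on x {..<m}" "inj_on y {..<m}"
    and disj: "x ` {..<m} \<inter> y ` {..<m} = {}"
    and step: "\<And>j. j < m \<Longrightarrow> x j \<rightarrow>\<^bsub>G\<^esub> y j" "\<And>j. j < m \<Longrightarrow> y j \<rightarrow>\<^bsub>G\<^esub> x (Suc j mod m)"
  shows "\<exists>p. cycle p \<and> cycle_verts G p = x ` {..<m} \<union> y ` {..<m}"
proof -
  \<comment> \<open>Interleaving of \<open>x\<close> and \<open>y\<close>. Among indices up to
    \<open>2 * m\<close>, the \<open>mod\<close> acts only at \<open>2 * m\<close> itself, where it
    returns to \<open>x 0\<close> and closes the sequence.\<close>
  define v where "v l = (if even l then x ((l div 2) mod m) else y (l div 2))" for l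
  have v_image: "v ` {..<2 * m} = x ` {..<m} \<union> y ` {..<m}"
  proof (intro equalityI subsetI)
    fix z assume "z \<in> v ` {..<2 * m}"
    then show "z \<in> x ` {..<m} \<union> y ` {..<m}"
      using \<open>0 < m\<close> by (auto simp: v_def split: if_splits)
  next
    fix z assume "z \<in> x ` {..<m} \<union> y ` {..<m}"
    then obtain j where "j < m" and "z = v (2 * j) \<or> z = v (2 * j + 1)"
      by (auto simp: v_def)
    then show "z \<in> v ` {..<2 * m}" by auto
  qed
  have "card (v ` {..<2 * m}) = 2 * m"
    unfolding v_image using disj inj by (simp add: card_Un_disjoint card_image)
  then have "inj_on v {..<2 * m}"
    by (intro eq_card_imp_inj_on) auto
  moreover have "v l \<rightarrow>\<^bsub>G\<^esub> v (Suc l)" if "l < 2 * m" for l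
    using that step[of "l div 2"] by (auto simp: v_def elim!: oddE)
  moreover have "v (2 * m) = v 0" by (simp add: v_def)
  ultimately show ?thesis
    using cycle_of_sequence[of "2 * m" v] \<open>0 < m\<close> v_image by simp
qed

context digraph
begin

text \<open>Degrees count arcs; without multiple arcs, \<open>head G\<close> is injective on the
  arcs leaving \<open>u\<close>, so they also count neighbours.\<close>

lemma out_degree_eq_card: "out_degree G u = card {v. u \<rightarrow>\<^bsub>G\<^esub> v}"
proof -
  have "inj_on (head G) (out_arcs G u)"
    by (auto intro!: inj_onI no_multi_arcs simp: arc_to_ends_def)
  moreover have "head G ` out_arcs G u = {v. u \<rightarrow>\<^bsub>G\<^esub> v}"
    by (auto simp: arcs_ends_conv)
  ultimately show ?thesis
    unfolding out_degree_def by (metis card_image)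
qed

lemma in_degree_eq_card: "in_degree G v = card {u. u \<rightarrow>\<^bsub>G\<^esub> v}"
proof -
  have "inj_on (tail G) (in_arcs G v)"
    by (auto intro!: inj_onI no_multi_arcs simp: arc_to_ends_def)
  moreover have "tail G ` in_arcs G v = {u. u \<rightarrow>\<^bsub>G\<^esub> v}"
    by (auto simp: arcs_ends_conv)
  ultimately show ?thesis
    unfolding in_degree_def by (metis card_image)
qed

text \<open>Inclusion-exclusion for the two neighbourhoods outside \<open>W\<close>. The degree
  bounds are doubled, with the subtraction moved across, to stay within natural numbers.\<close>

lemma card_common_outside_neighbours:
  assumes W: "W \<subseteq> verts G" and uv: "u \<in> W" "v \<in> W"
    and deg: "card (verts G) + 2 * card W \<le> 2 * out_degree G u + 2"
      "card (verts G) + 2 * card W \<le> 2 * in_degree G v + 2"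
  shows "card W \<le> card {z. z \<notin> W \<and> u \<rightarrow>\<^bsub>G\<^esub> z \<and> z \<rightarrow>\<^bsub>G\<^esub> v}"
proof -
  have finW: "finite W" using W finite_verts by (rule finite_subset)
  \<comment> \<open>\<open>N\<close> will be a neighbourhood of \<open>w\<close>. Loops being
    excluded, it misses \<open>w\<close> and so meets \<open>W\<close> in at most
    \<open>card W - 1\<close> vertices; this gain of one offsets the \<open>+ 2\<close>.\<close>
  have outside: "card (verts G) \<le> 2 * card (N - W)"
    if "N \<subseteq> verts G" "w \<in> W" "w \<notin> N" "card (verts G) + 2 * card W \<le> 2 * card N + 2" for N w
  proof -
    have "finite N" using that(1) finite_verts by (rule finite_subset)
    then have "card N = card (N - W) + card (N \<inter> W)"
      by (metis card_Diff_subset_Int card_mono finite_Int inf_le1 le_add_diff_inverse2)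
    moreover have "card (N \<inter> W) < card W"
      using finW that by (intro psubset_card_mono) auto
    ultimately show ?thesis using that(4) by linarith
  qed
  let ?A = "{z. u \<rightarrow>\<^bsub>G\<^esub> z} - W" and ?B = "{z. z \<rightarrow>\<^bsub>G\<^esub> v} - W"
  have "card (verts G) \<le> 2 * card ?A"
    using deg(1) uv(1) by (intro outside[of _ u])
      (auto simp: out_degree_eq_card dest: adj_in_verts adj_not_same)
  moreover have "card (verts G) \<le> 2 * card ?B"
    using deg(2) uv(2) by (intro outside[of _ v])
      (auto simp: in_degree_eq_card dest: adj_in_verts adj_not_same)
  moreover have sub: "?A \<subseteq> verts G - W" "?B \<subseteq> verts G - W"
    by (auto dest: adj_in_verts)
  then have fin: "finite ?A" "finite ?B"
    by (meson finite_Diff finite_subset finite_verts)+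
  moreover have "card (?A \<union> ?B) \<le> card (verts G) - card W"
    using sub card_mono[of "verts G - W" "?A \<union> ?B"] by (simp add: card_Diff_subset finW W)
  moreover have "card W \<le> card (verts G)"
    using W by (simp add: card_mono)
  moreover have "card ?A + card ?B = card (?A \<union> ?B) + card (?A \<inter> ?B)"
    using fin by (rule card_Un_Int)
  moreover have "?A \<inter> ?B = {z. z \<notin> W \<and> u \<rightarrow>\<^bsub>G\<^esub> z \<and> z \<rightarrow>\<^bsub>G\<^esub> v}" by auto
  ultimately show ?thesis by simp
qed

lemma arbitrary_cycle_factor_if_linked:
  assumes W: "W \<subseteq> verts G"
    and linked: "\<And>u v. \<lbrakk>u \<in> W; v \<in> W\<rbrakk>
      \<Longrightarrow> card W \<le> card {z. z \<notin> W \<and> u \<rightarrow>\<^bsub>G\<^esub> z \<and> z \<rightarrow>\<^bsub>G\<^esub> v}"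
  shows "arbitrary_cycle_factor G W"
  unfolding arbitrary_cycle_factor_def
proof (intro allI impI)
  fix k :: nat and m :: "nat \<Rightarrow> nat"
  assume m2: "\<forall>i\<in>{1..k}. 2 \<le> m i" and sum_m: "card W = (\<Sum>i=1..k. m i)"
  have finW: "finite W" using W finite_verts by (rule finite_subset)
  \<comment> \<open>A pair \<open>(i, j)\<close> is the \<open>j\<close>-th position on the
    \<open>i\<close>-th cycle. There are \<open>card W\<close> positions, so any bijection
    \<open>x\<close> distributes \<open>W\<close> over them.\<close>
  define I where "I = (SIGMA i:{1..k}. {..<m i})"
  have finI: "finite I" and cardI: "card I = card W"
    by (auto simp: I_def sum_m)
  then obtain x where x: "bij_betw x I W"
    using finW by (metis finite_same_card_bij)
  have xW: "x (i, j) \<in> W" if "i \<in> {1..k}" "j < m i" for i j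
    using that bij_betwE[OF x] by (auto simp: I_def)
  \<comment> \<open>The candidates for linking the vertex at \<open>(i, j)\<close> to its cyclic
    successor on the same cycle. Choosing representatives over all of \<open>I\<close> at once keeps
    the links of different cycles distinct too.\<close>
  define S where "S = (\<lambda>(i, j). {z. z \<notin> W \<and> x (i, j) \<rightarrow>\<^bsub>G\<^esub> z \<and> z \<rightarrow>\<^bsub>G\<^esub> x (i, Suc j mod m i)})"
  have "\<exists>y. inj_on y I \<and> (\<forall>a\<in>I. y a \<in> S a)"
  proof (rule greedy_distinct_representatives[OF finI])
    fix a assume "a \<in> I"
    then obtain i j where a: "a = (i, j)" "i \<in> {1..k}" "j < m i" by (auto simp: I_def)
    show "finite (S a)"
      by (rule finite_subset[OF _ finite_verts]) (auto simp: S_def a dest: adj_in_verts)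
    have "Suc j mod m i < m i" using a(3) by simp
    then show "card I \<le> card (S a)"
      unfolding cardI using linked[OF xW xW] a by (simp add: S_def)
  qed
  then obtain y where y_inj: "inj_on y I" and yS: "\<And>a. a \<in> I \<Longrightarrow> y a \<in> S a" by blast
  have y: "y (i, j) \<notin> W" "x (i, j) \<rightarrow>\<^bsub>G\<^esub> y (i, j)" "y (i, j) \<rightarrow>\<^bsub>G\<^esub> x (i, Suc j mod m i)"
    if "i \<in> {1..k}" "j < m i" for i j
    using yS[of "(i, j)"] that by (auto simp: I_def S_def)
  define X Y where "X i = (\<lambda>j. x (i, j)) ` {..<m i}" and "Y i = (\<lambda>j. y (i, j)) ` {..<m i}" for i
  have XW: "X i \<subseteq> W" and YW: "Y i \<inter> W = {}" if "i \<in> {1..k}" for i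
    using xW y(1) that by (auto simp: X_def Y_def)
  have inj: "inj_on (\<lambda>j. x (i, j)) {..<m i}" "inj_on (\<lambda>j. y (i, j)) {..<m i}"
    if "i \<in> {1..k}" for i
    using bij_betw_imp_inj_on[OF x] y_inj that unfolding inj_on_def I_def by blast+
  have "\<exists>p. cycle p \<and> cycle_verts G p = X i \<union> Y i" if i: "i \<in> {1..k}" for i
    unfolding X_def Y_def
  proof (rule cycle_alternating)
    show "0 < m i" using m2 i by fastforce
    show "(\<lambda>j. x (i, j)) ` {..<m i} \<inter> (\<lambda>j. y (i, j)) ` {..<m i} = {}"
      using XW[OF i] YW[OF i] unfolding X_def Y_def by blast
  qed (use inj[OF i] y[OF i] in auto)
  then obtain C where C: "\<And>i. i \<in> {1..k} \<Longrightarrow> cycle (C i)"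
    "\<And>i. i \<in> {1..k} \<Longrightarrow> cycle_verts G (C i) = X i \<union> Y i"
    by metis
  \<comment> \<open>Mixed intersections are empty because \<open>X\<close> parts lie in
    \<open>W\<close> and \<open>Y\<close> parts outside; the others are empty by injectivity of
    \<open>x\<close> and \<open>y\<close> on \<open>I\<close>.\<close>
  have "cycle_verts G (C i) \<inter> cycle_verts G (C j) = {}"
    if ij: "i \<in> {1..k}" "j \<in> {1..k}" "i \<noteq> j" for i j
  proof -
    have "X i \<inter> X j = {}" "Y i \<inter> Y j = {}"
      using bij_betw_imp_inj_on[OF x] y_inj ij unfolding inj_on_def I_def X_def Y_def by blast+
    then show ?thesis
      unfolding C(2)[OF ij(1)] C(2)[OF ij(2)]
      using XW[OF ij(1)] XW[OF ij(2)] YW[OF ij(1)] YW[OF ij(2)] by blast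
  qed
  moreover have "card (cycle_verts G (C i) \<inter> W) = m i" if i: "i \<in> {1..k}" for i
  proof -
    have "cycle_verts G (C i) \<inter> W = X i"
      using C(2)[OF i] XW[OF i] YW[OF i] by blast
    then show ?thesis using inj(1)[OF i] by (simp add: X_def card_image)
  qed
  ultimately show "\<exists>C. (\<forall>i\<in>{1..k}. cycle (C i)) \<and>
      (\<forall>i\<in>{1..k}. \<forall>j\<in>{1..k}. i \<noteq> j \<longrightarrow> cycle_verts G (C i) \<inter> cycle_verts G (C j) = {}) \<and>
      (\<forall>i\<in>{1..k}. card (cycle_verts G (C i) \<inter> W) = m i)"
    using C(1) by blast
qed

end

theorem theorem3:
  fixes D :: "('a, 'b) pre_digraph" and W :: "'a set" and n :: nat
  assumes "digraph D"
    and "card (verts D) = n"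
    and "W \<subseteq> verts D"
    and "n \<ge> 2 * card W"
    and "real (min_semi_degree D W) \<ge> real n / 2 + real (card W) - 1"
  shows "arbitrary_cycle_factor D W"
proof -
  interpret digraph D by fact
  have finW: "finite W" using assms(3) finite_verts by (rule finite_subset)
  show ?thesis
  proof (rule arbitrary_cycle_factor_if_linked[OF assms(3)])
    \<comment> \<open>Having \<open>u\<close> in \<open>W\<close> makes \<open>W\<close> nonempty,
      so both \<open>Min\<close> are genuine minima; for empty \<open>W\<close> there is nothing to
      link.\<close>
    fix u v assume uv: "u \<in> W" "v \<in> W"
    have "min_semi_degree D W \<le> out_degree D u" "min_semi_degree D W \<le> in_degree D v"
      using finW uv unfolding min_semi_degree_def min_out_degree_def min_in_degree_def
      by (auto intro: min.coboundedI1 min.coboundedI2)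
    moreover have "n + 2 * card W \<le> 2 * min_semi_degree D W + 2"
      using assms(5) by linarith
    ultimately show "card W \<le> card {z. z \<notin> W \<and> u \<rightarrow>\<^bsub>D\<^esub> z \<and> z \<rightarrow>\<^bsub>D\<^esub> v}"
      using uv assms(2,3) by (intro card_common_outside_neighbours) auto
  qed
qed

end
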